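(* Let $q$ be a prime power and let $k,m,t$ be positive integers with $m+t+2\le k$. Let $W$ be a fixed $(t-1)$-dimensional subspace of $\mathbb{F}_q^k$, and let $\mathcal{L}$ be the graph with vertex set contained in $\mathbb{X}\times\mathbb{Y}$ constructed from $(k,m,t,q,W)$ as described in the context. Then $\mathcal{L}$ is a $(c,d)$-caching line graph with $$c=\frac{q^{2m+3}}{2}\begin{bmatrix}k-m-t\\ 1\end{bmatrix}_q\begin{bmatrix}k-m-t-1\\ 1\end{bmatrix}_q,\qquad d=\binom{m+3}{2},$$ and it defines a coded caching scheme (with users indexed by $\mathbb{X}$ and subfiles indexed by $\mathbb{Y}$, in the sense described in the context) whose number of users $K$, subpacketization $F$, cached fraction $\frac{M}{N}$ and rate $R$ are $$K=\frac{q}{2}\begin{bmatrix}k-t+1\\ 1\end{bmatrix}_q\begin{bmatrix}k-t\\ 1\end{bmatrix}_q,$$ $$F=\begin{bmatrix}k-t+1\\ m+1\end{bmatrix}_q\frac{\prod_{i=0}^{m}(q^{m+1}-q^{i})}{(m+1)!\,(q-1)^{m+1}},$$ $$\frac{M}{N}=1-q^{2(m+1)}\,\frac{\begin{bmatrix}k-m-t\\ 1\end{bmatrix}_q\begin{bmatrix}k-m-t-1\\ 1\end{bmatrix}_q}{\begin{bmatrix}k-t+1\\ 1\end{bmatrix}_q\begin{bmatrix}k-t\\ 1\end{bmatrix}_q},$$ $$R=\frac{q^{2m+3}}{(m+2)(m+3)}\begin{bmatrix}k-m-t\\ 1\end{bmatrix}_q\begin{bmatrix}k-m-t-1\\ 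1\end{bmatrix}_q.$$
   Context: **$q$-binomial coefficients.** For integers $a\ge b\ge 1$, $\begin{bmatrix}a\\ b\end{bmatrix}_q=\frac{(q^a-1)(q^{a-1}-1)\cdots(q^{a-b+1}-1)}{(q^b-1)(q^{b-1}-1)\cdots(q-1)}$, the number of $b$-dimensional subspaces of an $a$-dimensional vector space over $\mathbb{F}_q$; $\begin{bmatrix}a\\ 0\end{bmatrix}_q=1$. **Construction of $\mathcal{L}$.** All subspaces are subspaces of $\mathbb{F}_q^k$, and sums of subspaces are the usual subspace sums. Let $\mathbb{V}$, $\mathbb{R}$, $\mathbb{S}$, $\mathbb{U}$ be the sets of subspaces containing $W$ of dimension $t$, $t+1$, $m+t$, $m+t+2$ respectively. Let - $\mathbb{X}=\{\{V_1,V_2\}: V_1,V_2\in\mathbb{V},\ V_1+V_2\in\mathbb{R}\}$, - $\mathbb{Y}=\{\{V_1,\dots,V_{m+1}\}: V_i\in\mathbb{V}\ \forall i,\ \sum_{i=1}^{m+1}V_i\in\mathbb{S}\}$. The vertex set of $\mathcal{L}$ is $V(\mathcal{L})=\{(X,Y)\in\mathbb{X}\times\mathbb{Y}:\ \sum_{V\in X}V+\sum_{V\in Y}V\in\mathbb{U}\}$, and two distinct vertices $(X,Y),(X',Y')$ are adjacent iff $X=X'$ or $Y=Y'$. **Caching line graphs.** Let $\mathcal{K},\mathcal{F}$ be finite sets with $|\mathcal{K}|=K$, $|\mathcal{F}|=F$. A simple graph $\mathcal{L}$ with $V(\mathcal{L})\subseteq\mathcal{K}\times\mathcal{F}$ and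 $KD$ vertices (for some positive integer $D$) is a caching line graph if (P1) for every $\kappa\in\mathcal{K}$ the set $\{(\kappa,f)\in V(\mathcal{L}): f\in\mathcal{F}\}$ is a clique of size $D$ (a user clique); (P2) there is a positive integer $c$ such that for every $f\in\mathcal{F}$ the set $\{(\kappa,f)\in V(\mathcal{L}):\kappa\in\mathcal{K}\}$ is a clique of size $c$ (a subfile clique); (P3) every edge lies within a user clique or within a subfile clique. The square $G^2$ of a graph $G$ has the same vertices as $G$, two distinct vertices being adjacent iff they are adjacent in $G$ or have a common neighbour in $G$. $\overline{\mathcal{L}^2}$ denotes the complement of $\mathcal{L}^2$. A clique cover of a graph is a partition of its vertex set into cliques. A caching line graph $\mathcal{L}$ (with subfile cliques of size $c$) is a $(c,d)$-caching line graph if $\overline{\mathcal{L}^2}$ has a clique cover consisting of disjoint cliques of size $d$. Here $\mathcal{K}=\mathbb{X}$ and $\mathcal{F}=\mathbb{Y}$. **Coded caching scheme defined by a $(c,d)$-caching line graph.** A server holds $N$ files $W_1,\dots,W_N$, each divided into $F$ equal-sized subfiles $W_{i,f}$, $f\in\mathcal{F}$, taking values in an Abelian group. There are $K$ users indexed by $\mathcal{K}$. Caching phase: user $\kappa$ stores $W_{i,f}$ for all $i\in\{1,\dots,N\}$ if $(\kappa,f)\notin V(\mathcal{L})$, and stores none of the $W_{i,f}$ otherwise. Delivery phase: each user $\kappa$ demands one file $W_{d_\kappa}$; for each clique $C$ in a clique cover of $\overline{\mathcal{L}^2}$ by $d$-sized cliques, the server broadcasts without error to all users the sum $\sum_{(\kappa,f)\in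 C}W_{d_\kappa,f}$. This being a coded caching scheme means that, for every choice of demands, every user can recover all subfiles of its demanded file from its cache and the transmissions. $F$ is the subpacketization; the cached fraction $\frac{M}{N}$ is the fraction of each file stored by each user (each user's cache stores $MF$ subfiles in total); the rate $R$ is the number of transmissions in the delivery phase divided by $F$. *)

theory Defs
  imports "HOL-Analysis.Analysis" "HOL-Library.Set_Algebras" "HOL-Library.Disjoint_Sets"
    "HOL-Library.FuncSet"
begin

definition qbinomial :: "nat \<Rightarrow> nat \<Rightarrow> nat \<Rightarrow> real" where
  "qbinomial q a b = (\<Prod>i<b. real q ^ (a - i) - 1) / (\<Prod>i<b. real q ^ (b - i) - 1)"

subsection \<open>Simple graphs\<close>

record 'v graph =
  vertices :: "'v set"
  adj :: "'v \<Rightarrow> 'v \<Rightarrow> bool"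

definition simple_graph :: "'v graph \<Rightarrow> bool" where
  "simple_graph G \<longleftrightarrow>
     (\<forall>u v. adj G u v \<longrightarrow> u \<in> vertices G \<and> v \<in> vertices G \<and> u \<noteq> v \<and> adj G v u)"

definition clique :: "'v graph \<Rightarrow> 'v set \<Rightarrow> bool" where
  "clique G C \<longleftrightarrow> C \<subseteq> vertices G \<and> (\<forall>u\<in>C. \<forall>v\<in>C. u \<noteq> v \<longrightarrow> adj G u v)"

definition graph_square :: "'v graph \<Rightarrow> 'v graph" where
  "graph_square G = \<lparr>vertices = vertices G,
     adj = (\<lambda>u v. u \<in> vertices G \<and> v \<in> vertices G \<and> u \<noteq> v \<and>
              (adj G u v \<or> (\<exists>w\<in>vertices G. adj G u w \<and> adj G v w)))\<rparr>"

definition graph_complement :: "'v graph \<Rightarrow> 'v graph" where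
  "graph_complement G = \<lparr>vertices = vertices G,
     adj = (\<lambda>u v. u \<in> vertices G \<and> v \<in> vertices G \<and> u \<noteq> v \<and> \<not> adj G u v)\<rparr>"

definition clique_cover :: "'v graph \<Rightarrow> 'v set set \<Rightarrow> bool" where
  "clique_cover G P \<longleftrightarrow> partition_on (vertices G) P \<and> (\<forall>C\<in>P. clique G C)"

subsection \<open>Caching line graphs\<close>

definition user_clique :: "('k \<times> 'f) graph \<Rightarrow> 'f set \<Rightarrow> 'k \<Rightarrow> ('k \<times> 'f) set" where
  "user_clique G Fs \<kappa> = {(\<kappa>, f) | f. f \<in> Fs \<and> (\<kappa>, f) \<in> vertices G}"

definition subfile_clique :: "('k \<times> 'f) graph \<Rightarrow> 'k set \<Rightarrow> 'f \<Rightarrow> ('k \<times> 'f) set" where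
  "subfile_clique G Ks f = {(\<kappa>, f) | \<kappa>. \<kappa> \<in> Ks \<and> (\<kappa>, f) \<in> vertices G}"

definition caching_line_graph ::
  "'k set \<Rightarrow> 'f set \<Rightarrow> nat \<Rightarrow> ('k \<times> 'f) graph \<Rightarrow> bool" where
  "caching_line_graph Ks Fs c G \<longleftrightarrow>
     finite Ks \<and> finite Fs \<and> simple_graph G \<and> vertices G \<subseteq> Ks \<times> Fs \<and>
     (\<exists>D>0. card (vertices G) = card Ks * D \<and>
        (\<forall>\<kappa>\<in>Ks. clique G (user_clique G Fs \<kappa>) \<and> card (user_clique G Fs \<kappa>) = D)) \<and>
     c > 0 \<and>
     (\<forall>f\<in>Fs. clique G (subfile_clique G Ks f) \<and> card (subfile_clique G Ks f) = c) \<and>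
     (\<forall>u v. adj G u v \<longrightarrow>
        (\<exists>\<kappa>\<in>Ks. {u, v} \<subseteq> user_clique G Fs \<kappa>) \<or>
        (\<exists>f\<in>Fs. {u, v} \<subseteq> subfile_clique G Ks f))"

definition delivery_cover :: "('k \<times> 'f) graph \<Rightarrow> nat \<Rightarrow> ('k \<times> 'f) set set \<Rightarrow> bool" where
  "delivery_cover G d P \<longleftrightarrow>
     clique_cover (graph_complement (graph_square G)) P \<and> (\<forall>C\<in>P. card C = d)"

definition cd_caching_line_graph ::
  "'k set \<Rightarrow> 'f set \<Rightarrow> nat \<Rightarrow> nat \<Rightarrow> ('k \<times> 'f) graph \<Rightarrow> bool" where
  "cd_caching_line_graph Ks Fs c d G \<longleftrightarrow>
     caching_line_graph Ks Fs c G \<and> (\<exists>P. delivery_cover G d P)"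

subsection \<open>The coded caching scheme of a caching line graph\<close>

text \<open>The library of files is a function \<open>Wf\<close>, where \<open>Wf i f\<close> is subfile \<open>f\<close> of file \<open>i\<close>.
  Only the files \<open>1, \<dots>, N\<close> and the subfiles indexed by \<open>Fs\<close> are relevant.\<close>

definition stored_subfiles :: "('k \<times> 'f) graph \<Rightarrow> 'f set \<Rightarrow> nat \<Rightarrow> 'k \<Rightarrow> (nat \<times> 'f) set" where
  "stored_subfiles G Fs N \<kappa> = {(i, f). i \<in> {1..N} \<and> f \<in> Fs \<and> (\<kappa>, f) \<notin> vertices G}"

definition cache_content ::
  "('k \<times> 'f) graph \<Rightarrow> 'f set \<Rightarrow> nat \<Rightarrow> (nat \<Rightarrow> 'f \<Rightarrow> 'g) \<Rightarrow> 'k \<Rightarrow> (nat \<times> 'f \<Rightarrow> 'g)" where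
  "cache_content G Fs N Wf \<kappa> = restrict (\<lambda>(i, f). Wf i f) (stored_subfiles G Fs N \<kappa>)"

definition transmissions ::
  "('k \<times> 'f) set set \<Rightarrow> ('k \<Rightarrow> nat) \<Rightarrow> (nat \<Rightarrow> 'f \<Rightarrow> 'g::ab_group_add)
    \<Rightarrow> (('k \<times> 'f) set \<Rightarrow> 'g)" where
  "transmissions P dem Wf = restrict (\<lambda>C. \<Sum>(\<kappa>, f)\<in>C. Wf (dem \<kappa>) f) P"

text \<open>Recoverability means that a decoder, which may depend on the user and on all the demands,
  computes the demanded file, whatever the contents \<open>Wf\<close> of the library are, from the cache
  content and the transmissions alone. The type argument is the Abelian group of subfile values.\<close>

definition coded_caching_scheme ::
  "'g::ab_group_add itself \<Rightarrow> 'k set \<Rightarrow> 'f set \<Rightarrow> nat \<Rightarrow> ('k \<times> 'f) graph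
    \<Rightarrow> ('k \<times> 'f) set set \<Rightarrow> bool" where
  "coded_caching_scheme _ Ks Fs N G P \<longleftrightarrow>
     (\<forall>dem. (\<forall>\<kappa>\<in>Ks. dem \<kappa> \<in> {1..N}) \<longrightarrow>
       (\<forall>\<kappa>\<in>Ks. \<exists>decode :: (nat \<times> 'f \<Rightarrow> 'g) \<Rightarrow> (('k \<times> 'f) set \<Rightarrow> 'g) \<Rightarrow> 'f \<Rightarrow> 'g.
          \<forall>Wf. \<forall>f\<in>Fs.
            decode (cache_content G Fs N Wf \<kappa>) (transmissions P dem Wf) f = Wf (dem \<kappa>) f))"

text \<open>\<open>M\<close> is the cache size measured in files: every user stores \<open>M * F\<close> subfiles in total and
  the fraction \<open>M / N\<close> of each single file.\<close>

definition has_cache_size ::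
  "'k set \<Rightarrow> 'f set \<Rightarrow> nat \<Rightarrow> ('k \<times> 'f) graph \<Rightarrow> real \<Rightarrow> bool" where
  "has_cache_size Ks Fs N G M \<longleftrightarrow>
     (\<forall>\<kappa>\<in>Ks. real (card (stored_subfiles G Fs N \<kappa>)) = M * real (card Fs) \<and>
        (\<forall>i\<in>{1..N}. real (card {f. (i, f) \<in> stored_subfiles G Fs N \<kappa>}) / real (card Fs)
           = M / real N))"

definition rate :: "'f set \<Rightarrow> ('k \<times> 'f) set set \<Rightarrow> real" where
  "rate Fs P = real (card P) / real (card Fs)"

subsection \<open>The graph constructed from subspaces\<close>

text \<open>Sums of subspaces are Minkowski sums of sets, as provided by \<open>HOL-Library.Set_Algebras\<close>.
  If \<open>dim W = t - 1\<close>, the dimension conditions in \<open>XX\<close> and \<open>YY\<close> force \<open>V1 \<noteq> V2\<close> and the \<open>m + 1\<close>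
  subspaces \<open>V i\<close> to be distinct, so representing the collections as plain sets loses nothing.\<close>

definition subspaces_above :: "('a::field ^ 'n) set \<Rightarrow> nat \<Rightarrow> ('a ^ 'n) set set" where
  "subspaces_above W r = {V. vec.subspace V \<and> W \<subseteq> V \<and> vec.dim V = r}"

definition XX :: "nat \<Rightarrow> ('a::field ^ 'n) set \<Rightarrow> ('a ^ 'n) set set set" where
  "XX t W = {{V1, V2} | V1 V2. V1 \<in> subspaces_above W t \<and> V2 \<in> subspaces_above W t \<and>
     V1 + V2 \<in> subspaces_above W (t + 1)}"

definition YY :: "nat \<Rightarrow> nat \<Rightarrow> ('a::field ^ 'n) set \<Rightarrow> ('a ^ 'n) set set set" where
  "YY m t W = {V ` {1..m + 1} | V :: nat \<Rightarrow> ('a ^ 'n) set.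
     (\<forall>i\<in>{1..m + 1}. V i \<in> subspaces_above W t) \<and>
     (\<Sum>i = 1..m + 1. V i) \<in> subspaces_above W (m + t)}"

definition subspace_vertices ::
  "nat \<Rightarrow> nat \<Rightarrow> ('a::field ^ 'n) set \<Rightarrow> (('a ^ 'n) set set \<times> ('a ^ 'n) set set) set" where
  "subspace_vertices m t W = {(X, Y) \<in> XX t W \<times> YY m t W.
     (\<Sum>V\<in>X. V) + (\<Sum>V\<in>Y. V) \<in> subspaces_above W (m + t + 2)}"

definition subspace_graph ::
  "nat \<Rightarrow> nat \<Rightarrow> ('a::field ^ 'n) set \<Rightarrow> (('a ^ 'n) set set \<times> ('a ^ 'n) set set) graph" where
  "subspace_graph m t W = \<lparr>vertices = subspace_vertices m t W,
     adj = (\<lambda>u v. u \<in> subspace_vertices m t W \<and> v \<in> subspace_vertices m t W \<and> u \<noteq> v \<and>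
              (fst u = fst v \<or> snd u = snd v))\<rparr>"

end

theory Submission imports Defs begin

text \<open>
  Modulo \<open>W\<close>, the \<open>t\<close>-dimensional subspaces above \<open>W\<close> are the points of a projective space over
  the field with \<open>q\<close> elements. Then \<open>XX\<close> consists of the pairs and \<open>YY\<close> of the \<open>(m + 1)\<close>-sets of
  independent points, and \<open>(X, Y)\<close> is a vertex iff \<open>X\<close> and \<open>Y\<close> are disjoint with independent union.
  A flat of rank \<open>r\<close> misses \<open>q ^ r * qbinomial q (k - t + 1 - r) 1\<close> points, so adding points one at
  a time counts the independent sets that extend a given one; this yields \<open>K\<close>, \<open>F\<close>, \<open>c\<close> and \<open>D\<close>.
  The vertices \<open>(X, Y)\<close> with a prescribed union \<open>Z\<close> form a clique of the complement of the square:
  two of them, with first components \<open>X \<noteq> X'\<close>, could only have \<open>(X, Z - X')\<close> or \<open>(X', Z - X)\<close> as a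
  common neighbour, and these are not disjoint. There are \<open>(m + 3) choose 2\<close> of them. For any cover
  by such cliques, a user that misses a subfile has cached all other summands of the transmission
  that contains it, as otherwise two vertices of the clique would have a common neighbour. Double
  counting of the vertices as \<open>K * D = F * c = d * card P\<close> gives the cached fraction and the rate.
\<close>

subsection \<open>Extensions of sets in an independence system\<close>

text \<open>Induction on \<open>s\<close> by double counting the inclusions between extensions of
  sizes \<open>s\<close> and \<open>s + 1\<close>. A smaller set grows in
  \<open>a (card B + s)\<close> ways; a larger one contains \<open>s + 1\<close> smaller ones, all
  independent by \<open>down\<close>. The factor \<open>fact s\<close> keeps the identity free of
  division.\<close>

lemma card_independent_extensions:
  fixes ind :: "'p set \<Rightarrow> bool" and a :: "nat \<Rightarrow> nat"
  assumes fin: "finite P"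
    and down: "\<And>S T. T \<subseteq> P \<Longrightarrow> ind T \<Longrightarrow> S \<subseteq> T \<Longrightarrow> ind S"
    and ext: "\<And>S. S \<subseteq> P \<Longrightarrow> ind S \<Longrightarrow> card {p \<in> P - S. ind (insert p S)} = a (card S)"
    and B: "B \<subseteq> P" "ind B"
  shows "fact s * card {Y. Y \<subseteq> P \<and> B \<inter> Y = {} \<and> card Y = s \<and> ind (B \<union> Y)}
    = (\<Prod>i<s. a (card B + i))"
proof (induction s)
  case 0
  have "{Y. Y \<subseteq> P \<and> B \<inter> Y = {} \<and> card Y = 0 \<and> ind (B \<union> Y)} = {{}}"
    using B fin by (auto dest: finite_subset)
  then show ?case by simp
next
  case (Suc s)
  define E where "E j = {Y. Y \<subseteq> P \<and> B \<inter> Y = {} \<and> card Y = j \<and> ind (B \<union> Y)}" for j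
  have finE: "finite (E j)" for j
    unfolding E_def using fin by simp
  have up: "card {Y' \<in> E (Suc s). Y \<subseteq> Y'} = a (card B + s)" if Y: "Y \<in> E s" for Y
  proof -
    have Y': "Y \<subseteq> P" "B \<inter> Y = {}" "card Y = s" "ind (B \<union> Y)" "finite Y" "finite B"
      using Y fin B by (auto simp: E_def dest: finite_subset)
    have "{Y' \<in> E (Suc s). Y \<subseteq> Y'}
        = (\<lambda>p. insert p Y) ` {p \<in> P - (B \<union> Y). ind (insert p (B \<union> Y))}" (is "?L = ?R")
    proof
      show "?L \<subseteq> ?R"
      proof
        fix Z assume Z: "Z \<in> ?L"
        then have "card (Z - Y) = 1"
          using Y' by (subst card_Diff_subset) (auto simp: E_def)
        then obtain p where "Z - Y = {p}" by (auto simp: card_1_singleton_iff)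
        then have "Z = insert p Y" "p \<notin> Y" using Z by auto
        then show "Z \<in> ?R" using Z by (auto simp: E_def intro!: imageI)
      qed
      show "?R \<subseteq> ?L" using Y' by (auto simp: E_def)
    qed
    moreover have "inj_on (\<lambda>p. insert p Y) {p \<in> P - (B \<union> Y). ind (insert p (B \<union> Y))}"
      by (auto simp: inj_on_def)
    moreover have "card (B \<union> Y) = card B + s" using Y' by (simp add: card_Un_disjoint)
    ultimately show ?thesis
      using ext[of "B \<union> Y"] Y' B by (simp add: card_image)
  qed
  have dn: "card {Y \<in> E s. Y \<subseteq> Y'} = Suc s" if Y': "Y' \<in> E (Suc s)" for Y'
  proof -
    have Y'': "Y' \<subseteq> P" "B \<inter> Y' = {}" "card Y' = Suc s" "ind (B \<union> Y')" "finite Y'"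
      using Y' fin B by (auto simp: E_def dest: finite_subset)
    have "{Y \<in> E s. Y \<subseteq> Y'} = (\<lambda>p. Y' - {p}) ` Y'" (is "?L = ?R")
    proof
      show "?L \<subseteq> ?R"
      proof
        fix Z assume Z: "Z \<in> ?L"
        then have "card (Y' - Z) = 1"
          using Y'' by (subst card_Diff_subset) (auto simp: E_def dest: finite_subset)
        then obtain p where "Y' - Z = {p}" by (auto simp: card_1_singleton_iff)
        then have "Z = Y' - {p}" "p \<in> Y'" using Z by auto
        then show "Z \<in> ?R" by auto
      qed
      have "ind (B \<union> (Y' - {p}))" for p
        using down[of "B \<union> Y'" "B \<union> (Y' - {p})"] Y'' B by auto
      then show "?R \<subseteq> ?L" using Y'' by (auto simp: E_def)
    qed
    moreover have "inj_on (\<lambda>p. Y' - {p}) Y'" by (auto simp: inj_on_def)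
    ultimately show ?thesis using Y'' by (simp add: card_image)
  qed
  have "card (E s) * a (card B + s) = (\<Sum>Y\<in>E s. card {Y' \<in> E (Suc s). Y \<subseteq> Y'})"
    using up by simp
  also have "\<dots> = (\<Sum>Y'\<in>E (Suc s). Suc s)"
    by (rule sum_multicount_gen) (use finE dn in auto)
  finally have "Suc s * card (E (Suc s)) = card (E s) * a (card B + s)" by simp
  then have "fact (Suc s) * card (E (Suc s)) = fact s * card (E s) * a (card B + s)"
    by (simp only: fact_Suc of_nat_id mult.assoc) (metis mult.left_commute)
  then show ?case using Suc.IH by (simp add: E_def)
qed

subsection \<open>Caching line graphs\<close>

text \<open>The subfile cliques partition the vertices, just as the user cliques do. Comparing both
  counts will relate \<open>D\<close> to \<open>c\<close>.\<close>

lemma card_eq_sum_subfile_cliques: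
  assumes "caching_line_graph Ks Fs c G"
  shows "card (vertices G) = card Fs * c"
proof -
  have fin: "finite Ks" "finite Fs" "vertices G \<subseteq> Ks \<times> Fs"
    and c: "\<And>f. f \<in> Fs \<Longrightarrow> card (subfile_clique G Ks f) = c"
    using assms by (auto simp: caching_line_graph_def)
  have "vertices G = (\<Union>f\<in>Fs. subfile_clique G Ks f)"
    using fin by (auto simp: subfile_clique_def)
  moreover have "finite (subfile_clique G Ks f)" for f
    by (rule finite_subset[of _ "Ks \<times> {f}"]) (auto simp: subfile_clique_def fin)
  moreover have "\<forall>f\<in>Fs. \<forall>g\<in>Fs. f \<noteq> g \<longrightarrow> subfile_clique G Ks f \<inter> subfile_clique G Ks g = {}"
    by (auto simp: subfile_clique_def)
  ultimately show ?thesis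
    using card_UN_disjoint[of Fs "subfile_clique G Ks"] fin c by simp
qed

text \<open>The vertex \<open>(\<kappa>, f')\<close> would lie in the user clique of the first
  vertex and in the subfile clique of the second, so these would be at distance at most two. Hence
  user \<open>\<kappa>\<close> has cached subfile \<open>f'\<close>.\<close>

lemma delivery_clique_cached:
  assumes G: "caching_line_graph Ks Fs c G"
    and C: "clique (graph_complement (graph_square G)) C"
    and u: "(\<kappa>, f) \<in> C" and v: "(\<kappa>', f') \<in> C" and ne: "(\<kappa>, f) \<noteq> (\<kappa>', f')"
  shows "(\<kappa>, f') \<notin> vertices G"
proof
  assume w: "(\<kappa>, f') \<in> vertices G"
  have V: "vertices G \<subseteq> Ks \<times> Fs"
    and row: "\<And>\<kappa>. \<kappa> \<in> Ks \<Longrightarrow> clique G (user_clique G Fs \<kappa>)"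
    and col: "\<And>f. f \<in> Fs \<Longrightarrow> clique G (subfile_clique G Ks f)"
    using G by (auto simp: caching_line_graph_def)
  have uv: "(\<kappa>, f) \<in> vertices G" "(\<kappa>', f') \<in> vertices G"
    using C u v by (auto simp: clique_def graph_complement_def graph_square_def)
  have mem: "\<kappa> \<in> Ks" "\<kappa>' \<in> Ks" "f \<in> Fs" "f' \<in> Fs"
    using V uv by auto
  have nonadj: "\<not> adj G (\<kappa>, f) (\<kappa>', f')"
    "\<not> (adj G (\<kappa>, f) (\<kappa>, f') \<and> adj G (\<kappa>', f') (\<kappa>, f'))"
    using C u v ne w uv by (auto simp: clique_def graph_complement_def graph_square_def)
  have r: "adj G (\<kappa>, f) (\<kappa>, f')" if "f \<noteq> f'"
    using row[of \<kappa>] mem uv w that by (auto simp: clique_def user_clique_def)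
  have s: "adj G (\<kappa>', f') (\<kappa>, f')" if "\<kappa> \<noteq> \<kappa>'"
    using col[of f'] mem uv w that by (auto simp: clique_def subfile_clique_def)
  have s': "adj G (\<kappa>, f) (\<kappa>', f')" if "\<kappa> \<noteq> \<kappa>'" "f = f'"
    using col[of f'] mem uv w that by (auto simp: clique_def subfile_clique_def)
  \<comment> \<open>A shared user makes the two vertices adjacent by \<open>r\<close>, a shared
    subfile by \<open>s'\<close>; otherwise \<open>r\<close> and \<open>s\<close> give a common
    neighbour.\<close>
  show False using nonadj r s s' ne by blast
qed

text \<open>To obtain a missing subfile, a user takes the transmission of the clique containing it
  and subtracts the other summands, which are all cached by
  \<open>delivery_clique_cached\<close>.\<close>

lemma coded_caching_scheme_delivery_cover:
  fixes G :: "('k \<times> 'f) graph"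
  assumes G: "caching_line_graph Ks Fs c G" and P: "delivery_cover G d P"
  shows "coded_caching_scheme TYPE('g::ab_group_add) Ks Fs N G P"
  unfolding coded_caching_scheme_def
proof (intro allI impI ballI)
  fix dem \<kappa> assume dem: "\<forall>\<kappa>\<in>Ks. dem \<kappa> \<in> {1..N}" and \<kappa>: "\<kappa> \<in> Ks"
  have V: "vertices G \<subseteq> Ks \<times> Fs" "finite (vertices G)"
    using G by (auto simp: caching_line_graph_def dest: finite_subset)
  have part: "partition_on (vertices G) P"
    and cl: "\<And>C. C \<in> P \<Longrightarrow> clique (graph_complement (graph_square G)) C"
    using P by (auto simp: delivery_cover_def clique_cover_def graph_complement_def graph_square_def)
  \<comment> \<open>Both \<open>cell\<close> and \<open>decode\<close> depend on the user, the
    demands and the cover, but not on the library \<open>Wf\<close>, as the order of quantifiers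
    demands.\<close>
  define cell where "cell f = (SOME C. C \<in> P \<and> (\<kappa>, f) \<in> C)" for f
  define decode :: "(nat \<times> 'f \<Rightarrow> 'g) \<Rightarrow> (('k \<times> 'f) set \<Rightarrow> 'g) \<Rightarrow> 'f \<Rightarrow> 'g" where
    "decode cache tr f = (if (\<kappa>, f) \<notin> vertices G then cache (dem \<kappa>, f)
       else tr (cell f) - (\<Sum>(\<kappa>', f')\<in>cell f - {(\<kappa>, f)}. cache (dem \<kappa>', f')))" for cache tr f
  have "decode (cache_content G Fs N Wf \<kappa>) (transmissions P dem Wf) f = Wf (dem \<kappa>) f"
    if f: "f \<in> Fs" for Wf f
  proof (cases "(\<kappa>, f) \<in> vertices G")
    case False
    then show ?thesis
      using dem \<kappa> f by (auto simp: decode_def cache_content_def stored_subfiles_def)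
  next
    case True
    then have "\<exists>C. C \<in> P \<and> (\<kappa>, f) \<in> C"
      using part by (auto simp: partition_on_def)
    then have C: "cell f \<in> P" "(\<kappa>, f) \<in> cell f"
      using someI_ex[of "\<lambda>C. C \<in> P \<and> (\<kappa>, f) \<in> C"] by (simp_all add: cell_def)
    have sub: "cell f \<subseteq> vertices G"
      using C part by (auto simp: partition_on_def)
    have "(\<Sum>(\<kappa>', f')\<in>cell f - {(\<kappa>, f)}. cache_content G Fs N Wf \<kappa> (dem \<kappa>', f'))
        = (\<Sum>(\<kappa>', f')\<in>cell f - {(\<kappa>, f)}. Wf (dem \<kappa>') f')"
    proof (rule sum.cong[OF refl])
      fix p assume p: "p \<in> cell f - {(\<kappa>, f)}"
      obtain \<kappa>' f' where pq: "p = (\<kappa>', f')" by (cases p)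
      then have "(\<kappa>', f') \<in> cell f" "(\<kappa>, f) \<noteq> (\<kappa>', f')" using p by auto
      then have "(\<kappa>, f') \<notin> vertices G" "\<kappa>' \<in> Ks" "f' \<in> Fs"
        using delivery_clique_cached[OF G cl[OF C(1)] C(2)] sub V by auto
      then show "(case p of (\<kappa>', f') \<Rightarrow> cache_content G Fs N Wf \<kappa> (dem \<kappa>', f'))
          = (case p of (\<kappa>', f') \<Rightarrow> Wf (dem \<kappa>') f')"
        using dem by (auto simp: pq cache_content_def stored_subfiles_def)
    qed
    moreover have "transmissions P dem Wf (cell f)
        = Wf (dem \<kappa>) f + (\<Sum>(\<kappa>', f')\<in>cell f - {(\<kappa>, f)}. Wf (dem \<kappa>') f')"
      using C sum.remove[of "cell f" "(\<kappa>, f)" "\<lambda>(\<kappa>', f'). Wf (dem \<kappa>') f'"]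
        finite_subset[OF sub V(2)] by (simp add: transmissions_def)
    ultimately show ?thesis using True by (simp add: decode_def)
  qed
  then show "\<exists>decode :: (nat \<times> 'f \<Rightarrow> 'g) \<Rightarrow> (('k \<times> 'f) set \<Rightarrow> 'g) \<Rightarrow> 'f \<Rightarrow> 'g.
      \<forall>Wf. \<forall>f\<in>Fs. decode (cache_content G Fs N Wf \<kappa>) (transmissions P dem Wf) f = Wf (dem \<kappa>) f"
    by blast
qed

section \<open>Rate and cache size by counting\<close>

text \<open>The vertices are counted twice: \<open>d\<close> in each clique of \<open>P\<close> and
  \<open>c\<close> in each subfile clique.\<close>

lemma rate_delivery_cover:
  assumes G: "caching_line_graph Ks Fs c G" and P: "delivery_cover G d P"
    and "Fs \<noteq> {}" "d > 0"
  shows "rate Fs P = real c / real d"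
proof -
  have fin: "finite (vertices G)" "card Fs > 0"
    using G assms(3) by (auto simp: caching_line_graph_def card_gt_0_iff dest: finite_subset)
  have part: "partition_on (vertices G) P" and d: "\<forall>C\<in>P. card C = d"
    using P by (auto simp: delivery_cover_def clique_cover_def graph_complement_def graph_square_def)
  have "d * card P = card (\<Union>P)"
    using part fin d
    by (intro card_partition) (auto simp: partition_on_def disjoint_def intro: finite_UnionD)
  also have "\<dots> = card Fs * c"
    using part card_eq_sum_subfile_cliques[OF G] by (simp add: partition_on_def)
  finally have "real d * real (card P) = real (card Fs) * real c"
    by (metis of_nat_mult)
  then show ?thesis using fin \<open>d > 0\<close> by (simp add: rate_def field_simps)
qed

text \<open>Of every file a user lacks exactly the \<open>D\<close> subfiles that occur in its user
  clique.\<close>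

lemma has_cache_size_user_clique:
  assumes G: "caching_line_graph Ks Fs c G"
    and D: "\<And>\<kappa>. \<kappa> \<in> Ks \<Longrightarrow> card (user_clique G Fs \<kappa>) = D"
    and "Fs \<noteq> {}" "N > 0"
  shows "has_cache_size Ks Fs N G (real N * (1 - real D / real (card Fs)))"
  unfolding has_cache_size_def
proof (intro ballI conjI)
  have fin: "finite Fs" "card Fs > 0"
    using G assms(3) by (auto simp: caching_line_graph_def card_gt_0_iff)
  fix \<kappa> assume \<kappa>: "\<kappa> \<in> Ks"
  define A where "A = {f \<in> Fs. (\<kappa>, f) \<in> vertices G}"
  have "user_clique G Fs \<kappa> = Pair \<kappa> ` A"
    by (auto simp: user_clique_def A_def)
  then have "card A = D" using D[OF \<kappa>] by (simp add: card_image inj_on_def)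
  moreover have "card A \<le> card Fs" using fin by (auto simp: A_def intro: card_mono)
  moreover have "card (Fs - A) = card Fs - card A"
    using fin by (intro card_Diff_subset) (auto simp: A_def)
  ultimately have c: "real (card (Fs - A)) = real (card Fs) - real D"
    by simp
  have "stored_subfiles G Fs N \<kappa> = {1..N} \<times> (Fs - A)"
    by (auto simp: stored_subfiles_def A_def)
  then have st: "card (stored_subfiles G Fs N \<kappa>) = N * card (Fs - A)"
    by (simp add: card_cartesian_product)
  show "real (card (stored_subfiles G Fs N \<kappa>))
      = real N * (1 - real D / real (card Fs)) * real (card Fs)"
    unfolding st of_nat_mult c using fin \<open>Fs \<noteq> {}\<close> by (simp add: field_simps)
  fix i assume "i \<in> {1..N}"
  then have "{f. (i, f) \<in> stored_subfiles G Fs N \<kappa>} = Fs - A"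
    by (auto simp: stored_subfiles_def A_def)
  then show "real (card {f. (i, f) \<in> stored_subfiles G Fs N \<kappa>}) / real (card Fs)
      = real N * (1 - real D / real (card Fs)) / real N"
    using fin \<open>Fs \<noteq> {}\<close> \<open>N > 0\<close> by (simp add: c diff_divide_distrib)
qed

section \<open>Construction of line graphs and delivery covers\<close>

text \<open>When adjacency means agreement in one component, rows and columns are cliques and every
  edge lies in one of them; only constant row and column sizes have to be supplied. The record has
  the shape of \<open>subspace_graph_def\<close>, so that the result can be folded.\<close>

lemma caching_line_graph_product:
  fixes V :: "('k \<times> 'f) set"
  assumes fin: "finite Ks" "finite Fs" and V: "V \<subseteq> Ks \<times> Fs"
    and row: "\<And>\<kappa>. \<kappa> \<in> Ks \<Longrightarrow> card {f \<in> Fs. (\<kappa>, f) \<in> V} = D" and "D > 0"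
    and col: "\<And>f. f \<in> Fs \<Longrightarrow> card {\<kappa> \<in> Ks. (\<kappa>, f) \<in> V} = c" and "c > 0"
  defines "G \<equiv> \<lparr>vertices = V, adj = (\<lambda>u v. u \<in> V \<and> v \<in> V \<and> u \<noteq> v \<and> (fst u = fst v \<or> snd u = snd v))\<rparr>"
  shows "caching_line_graph Ks Fs c G"
    and "\<And>\<kappa>. \<kappa> \<in> Ks \<Longrightarrow> card (user_clique G Fs \<kappa>) = D"
    and "card V = card Ks * D"
proof -
  have uc: "user_clique G Fs \<kappa> = Pair \<kappa> ` {f \<in> Fs. (\<kappa>, f) \<in> V}" for \<kappa>
    by (auto simp: user_clique_def G_def)
  show D: "card (user_clique G Fs \<kappa>) = D" if "\<kappa> \<in> Ks" for \<kappa>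
    using row[OF that] by (simp add: uc card_image inj_on_def)
  have sc: "subfile_clique G Ks f = (\<lambda>\<kappa>. (\<kappa>, f)) ` {\<kappa> \<in> Ks. (\<kappa>, f) \<in> V}" for f
    by (auto simp: subfile_clique_def G_def)
  have c: "card (subfile_clique G Ks f) = c" if "f \<in> Fs" for f
    using col[OF that] by (simp add: sc card_image inj_on_def)
  have "V = (\<Union>\<kappa>\<in>Ks. user_clique G Fs \<kappa>)"
    using V by (auto simp: uc)
  then show card: "card V = card Ks * D"
    using card_UN_disjoint[of Ks "user_clique G Fs"] fin D by (simp add: uc) blast
  have cl: "clique G (user_clique G Fs \<kappa>)" "clique G (subfile_clique G Ks f)" for \<kappa> f
    unfolding uc sc by (auto simp: clique_def G_def)
  have adj: "(\<exists>\<kappa>\<in>Ks. {u, v} \<subseteq> user_clique G Fs \<kappa>) \<or> (\<exists>f\<in>Fs. {u, v} \<subseteq> subfile_clique G Ks f)"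
    if "adj G u v" for u v
  proof -
    obtain \<kappa> f \<kappa>' f' where uv: "u = (\<kappa>, f)" "v = (\<kappa>', f')" by (cases u, cases v)
    have mem: "(\<kappa>, f) \<in> V" "(\<kappa>', f') \<in> V" "\<kappa> \<in> Ks" "f \<in> Fs" "\<kappa>' \<in> Ks" "f' \<in> Fs"
      and "\<kappa> = \<kappa>' \<or> f = f'"
      using that V by (auto simp: G_def uv)
    then show ?thesis unfolding uc sc uv by blast
  qed
  have "simple_graph G" by (auto simp: simple_graph_def G_def)
  moreover have "vertices G = V" by (simp add: G_def)
  ultimately show "caching_line_graph Ks Fs c G"
    unfolding caching_line_graph_def using fin V cl D c adj card \<open>D > 0\<close> \<open>c > 0\<close> by auto
qed

text \<open>A class consists of the vertices with a given union \<open>Z\<close>. By disjointness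
  such a vertex is \<open>(X, Z - X)\<close>, and by \<open>all\<close> every
  \<open>r\<close>-subset \<open>X\<close> of \<open>Z\<close> occurs, whence the binomial
  coefficient.\<close>

lemma delivery_cover_unions:
  assumes G: "simple_graph G"
    and adj: "\<And>u v. adj G u v \<Longrightarrow> fst u = fst v \<or> snd u = snd v"
    and disj: "\<And>X Y. (X, Y) \<in> vertices G \<Longrightarrow> X \<inter> Y = {}"
    and card: "\<And>X Y. (X, Y) \<in> vertices G \<Longrightarrow> finite (X \<union> Y) \<and> card (X \<union> Y) = s"
    and sub: "\<And>X Y. (X, Y) \<in> vertices G \<Longrightarrow> card X = r"
    and all: "\<And>X Y X'. (X, Y) \<in> vertices G \<Longrightarrow> X' \<subseteq> X \<union> Y \<Longrightarrow> card X' = r \<Longrightarrow>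
      (X', (X \<union> Y) - X') \<in> vertices G"
  shows "delivery_cover G (s choose r)
    ((\<lambda>Z. {(X, Y) \<in> vertices G. X \<union> Y = Z}) ` (\<lambda>(X, Y). X \<union> Y) ` vertices G)"
proof -
  let ?cell = "\<lambda>Z. {(X, Y) \<in> vertices G. X \<union> Y = Z}"
  let ?P = "?cell ` (\<lambda>(X, Y). X \<union> Y) ` vertices G"
  have "partition_on (vertices G) ?P"
    by (auto simp: partition_on_def disjoint_def)
  moreover have "clique (graph_complement (graph_square G)) (?cell Z)" for Z
  proof -
    have "\<not> adj (graph_square G) (X, Y) (X', Y')"
      if v: "(X, Y) \<in> vertices G" "(X', Y') \<in> vertices G" "X \<union> Y = X' \<union> Y'"
        and ne: "(X, Y) \<noteq> (X', Y')" for X Y X' Y'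
    proof -
      have Y: "Y = (X \<union> Y) - X" "Y' = (X \<union> Y) - X'"
        using disj[OF v(1)] disj[OF v(2)] v(3) by auto
      then have nX: "X \<noteq> X'" using ne by metis
      have "X \<subseteq> X \<union> Y" "X' \<subseteq> X \<union> Y" using v(3) by auto
      then have nY: "Y \<noteq> Y'" using Y nX by blast
      have "card X = card X'" "finite X" "finite X'"
        using sub[OF v(1)] sub[OF v(2)] card[OF v(1)] card[OF v(2)] by auto
      then have "\<not> X \<subseteq> X'" "\<not> X' \<subseteq> X"
        using nX card_subset_eq[of X' X] card_subset_eq[of X X'] by auto
      \<comment> \<open>An element of \<open>X\<close> outside \<open>X'\<close> must lie in
        \<open>Y'\<close>, because the unions agree.\<close>
      then have "X \<inter> Y' \<noteq> {}" "X' \<inter> Y \<noteq> {}"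
        using v(3) by blast+
      then have "(X, Y') \<notin> vertices G" "(X', Y) \<notin> vertices G"
        using disj by blast+
      \<comment> \<open>The vertices differ in both components, so a common neighbour could only be
        \<open>(X, Y')\<close> or \<open>(X', Y)\<close>.\<close>
      then have "\<not> (adj G (X, Y) w \<and> adj G (X', Y') w)" if "w \<in> vertices G" for w
        using nX nY adj[of "(X, Y)" w] adj[of "(X', Y')" w] that by (cases w) auto
      moreover have "\<not> adj G (X, Y) (X', Y')"
        using nX nY adj[of "(X, Y)" "(X', Y')"] by auto
      ultimately show ?thesis by (simp add: graph_square_def)
    qed
    moreover have "vertices (graph_square G) = vertices G" by (simp add: graph_square_def)
    ultimately show ?thesis by (auto simp: clique_def graph_complement_def)
  qed
  moreover have "card (?cell (X \<union> Y)) = s choose r" if v: "(X, Y) \<in> vertices G" for X Y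
  proof -
    have "?cell (X \<union> Y) = (\<lambda>X'. (X', (X \<union> Y) - X')) ` {X'. X' \<subseteq> X \<union> Y \<and> card X' = r}"
      (is "_ = ?R")
    proof
      show "?cell (X \<union> Y) \<subseteq> ?R"
      proof clarify
        fix X' Y' assume v': "(X', Y') \<in> vertices G" "X' \<union> Y' = X \<union> Y"
        then have "Y' = (X \<union> Y) - X'" using disj[OF v'(1)] by auto
        then show "(X', Y') \<in> ?R" using v' sub[OF v'(1)] by auto
      qed
      show "?R \<subseteq> ?cell (X \<union> Y)" using all[OF v] by auto
    qed
    moreover have "inj_on (\<lambda>X'. (X', (X \<union> Y) - X')) {X'. X' \<subseteq> X \<union> Y \<and> card X' = r}"
      by (auto simp: inj_on_def)
    ultimately show ?thesis
      using card[OF v] n_subsets[of "X \<union> Y" r] by (simp add: card_image)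
  qed
  ultimately show ?thesis
    by (auto simp: delivery_cover_def clique_cover_def graph_complement_def graph_square_def)
qed

subsection \<open>Gaussian binomial coefficients\<close>

text \<open>The geometric sum shows that these coefficients are natural numbers, so point counts can
  be stated in \<open>nat\<close>. For \<open>x = 0\<close> both sides vanish.\<close>

lemma qbinomial_one_eq_sum: "q > 1 \<Longrightarrow> qbinomial q x 1 = (\<Sum>j<x. real q ^ j)"
  by (simp add: qbinomial_def geometric_sum)

lemma qbinomial_one_pos: "q > 1 \<Longrightarrow> x > 0 \<Longrightarrow> qbinomial q x 1 > 0"
  unfolding qbinomial_one_eq_sum by (intro sum_pos) auto

text \<open>Taking \<open>q ^ i\<close> out of each factor \<open>q ^ b - q ^ i\<close> leaves the
  denominator of \<open>qbinomial q n b\<close>. This turns the point-by-point count into the closed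
  form of \<open>F\<close>.\<close>

lemma qbinomial_mult_prod_diff:
  assumes "q > 1"
  shows "qbinomial q n b * ((\<Prod>i<b. real q ^ b - real q ^ i) / (real q - 1) ^ b)
    = (\<Prod>i<b. real q ^ i * qbinomial q (n - i) 1)"
proof -
  define A D E where "A = (\<Prod>i<b. real q ^ (n - i) - 1)" and "D = (\<Prod>i<b. real q ^ (b - i) - 1)"
    and "E = (\<Prod>i<b. real q ^ i)"
  have "(\<Prod>i<b. real q ^ b - real q ^ i) = (\<Prod>i<b. real q ^ i * (real q ^ (b - i) - 1))"
    by (rule prod.cong) (auto simp: right_diff_distrib simp flip: power_add)
  then have "(\<Prod>i<b. real q ^ b - real q ^ i) = E * D"
    by (simp add: prod.distrib D_def E_def)
  moreover have "real q ^ (b - i) - 1 \<noteq> 0" if "i < b" for i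
  proof -
    have "1 < real q ^ (b - i)" by (rule one_less_power) (use assms that in auto)
    then show ?thesis by simp
  qed
  then have "D \<noteq> 0" by (simp add: D_def)
  moreover have "(\<Prod>i<b. real q ^ i * qbinomial q (n - i) 1) = E * (A / (real q - 1) ^ b)"
    by (simp add: qbinomial_def prod.distrib prod_dividef A_def E_def)
  moreover have "qbinomial q n b = A / D" by (simp add: qbinomial_def A_def D_def)
  ultimately show ?thesis by simp
qed

lemma two_mult_choose_two: "2 * (n choose 2) = n * (n - 1)"
  using binomial_absorption[of 1 n] by (simp add: numeral_2_eq_2)

subsection \<open>Independence of subspaces above a fixed subspace\<close>

text \<open>Induction along a basis: for \<open>b\<close> outside the span of \<open>B\<close>, the
  map from \<open>(r, x)\<close> to \<open>r *s b + x\<close> is a bijection onto the enlarged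
  span.\<close>

lemma card_subspace:
  fixes S :: "('a::{field,finite} ^ 'n) set"
  assumes "vec.subspace S"
  shows "card S = CARD('a) ^ vec.dim S"
proof -
  have span: "card (vec.span B) = CARD('a) ^ card B" if "finite B" "vec.independent B"
    for B :: "('a ^ 'n) set"
    using that
  proof (induction B)
    case (insert b B)
    then have b: "b \<notin> vec.span B" and B: "vec.independent B"
      by (auto simp: vec.independent_insert)
    have "vec.span (insert b B) = (\<lambda>(r, x). r *s b + x) ` (UNIV \<times> vec.span B)"
    proof safe
      fix x assume "x \<in> vec.span (insert b B)"
      then obtain r where "x - r *s b \<in> vec.span B"
        by (auto simp: vec.span_insert)
      then show "x \<in> (\<lambda>(r, x). r *s b + x) ` (UNIV \<times> vec.span B)"
        by (intro image_eqI[of _ _ "(r, x - r *s b)"]) auto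
    next
      fix r x assume "x \<in> vec.span B"
      then have "x \<in> vec.span (insert b B)" using vec.span_mono[of B "insert b B"] by blast
      then show "r *s b + x \<in> vec.span (insert b B)"
        by (intro vec.span_add vec.span_scale) (auto intro: vec.span_base)
    qed
    moreover have "inj_on (\<lambda>(r, x). r *s b + x) (UNIV \<times> vec.span B)"
    proof (rule inj_onI, clarify)
      fix r x s y assume x: "x \<in> vec.span B" "y \<in> vec.span B" and eq: "r *s b + x = s *s b + y"
      have *: "(r - s) *s b = y - x"
        using eq by (simp add: vec.scale_left_diff_distrib algebra_simps)
      have "r = s"
      proof (rule ccontr)
        assume "r \<noteq> s"
        then have "b = inverse (r - s) *s ((r - s) *s b)"
          using \<open>r \<noteq> s\<close> by (simp only: vec.scale_scale left_inverse right_minus_eq vec.scale_one simp_thms)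
        also have "\<dots> \<in> vec.span B" unfolding * using x by (intro vec.span_scale vec.span_diff)
        finally show False using b by simp
      qed
      then show "r = s \<and> x = y" using eq by simp
    qed
    ultimately show ?case
      using insert.IH[OF B] insert.hyps by (simp add: card_image card_cartesian_product)
  qed simp
  obtain B where "B \<subseteq> S" "vec.independent B" "S \<subseteq> vec.span B" "card B = vec.dim S"
    using vec.basis_exists .
  then show ?thesis
    using span[of B] vec.span_subspace[of B S] assms by simp
qed

section \<open>Joins, independence and atoms over a subspace\<close>

definition join_above :: "('a::field ^ 'n) set \<Rightarrow> ('a ^ 'n) set set \<Rightarrow> ('a ^ 'n) set" where
  "join_above W S = vec.span (W \<union> \<Union>S)"

text \<open>For finite sets of atoms this is linear independence of the lines \<open>V / W\<close>
  in the quotient by \<open>W\<close>, phrased by dimensions so that no quotient space is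
  formed.\<close>

definition independent_above :: "('a::field ^ 'n) set \<Rightarrow> ('a ^ 'n) set set \<Rightarrow> bool" where
  "independent_above W S \<longleftrightarrow> vec.dim (join_above W S) = vec.dim W + card S"

lemma subspace_join_above [simp]: "vec.subspace (join_above W S)"
  by (simp add: join_above_def)

lemma join_above_superset: "W \<subseteq> join_above W S"
  unfolding join_above_def by (meson Un_upper1 order_trans vec.span_superset)

lemma join_above_empty: "vec.subspace W \<Longrightarrow> join_above W {} = W"
  by (simp add: join_above_def vec.span_eq_iff[THEN iffD2])

text \<open>These are the points of the projective space of the quotient by
  \<open>W\<close>.\<close>

abbreviation atoms_above :: "('a::field ^ 'n) set \<Rightarrow> ('a ^ 'n) set set" where
  "atoms_above W \<equiv> subspaces_above W (Suc (vec.dim W))"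

lemma atoms_above_eq_span_insert:
  assumes "V \<in> atoms_above W" "v \<in> V" "v \<notin> W" and W: "vec.subspace W"
  shows "V = vec.span (insert v W)"
proof (rule sym, rule vec.subspace_dim_equal)
  have V: "vec.subspace V" "W \<subseteq> V" "vec.dim V = Suc (vec.dim W)"
    using assms(1) by (auto simp: subspaces_above_def)
  then show "vec.span (insert v W) \<subseteq> V"
    using assms(2) by (intro vec.span_minimal) auto
  show "vec.dim V \<le> vec.dim (vec.span (insert v W))"
    using V assms(3) W by (simp add: vec.dim_insert vec.span_eq_iff[THEN iffD2])
qed (use assms in \<open>auto simp: subspaces_above_def\<close>)

lemma atoms_above_obtain_generator:
  assumes V: "V \<in> atoms_above W" and W: "vec.subspace W"
  obtains v where "v \<in> V" "v \<notin> W" "V = vec.span (insert v W)"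
proof -
  have "\<not> V \<subseteq> W"
    using V vec.dim_subset[of V W] by (auto simp: subspaces_above_def)
  then obtain v where "v \<in> V" "v \<notin> W" by blast
  then show thesis using atoms_above_eq_span_insert[OF V _ _ W] that by blast
qed

text \<open>Over \<open>W\<close> an atom is generated by one vector, so adjoining it amounts to
  adjoining that vector to the spanning set.\<close>

lemma dim_join_above_insert:
  assumes V: "V \<in> atoms_above W" and W: "vec.subspace W"
  shows "vec.dim (join_above W (insert V S))
    = vec.dim (join_above W S) + (if V \<subseteq> join_above W S then 0 else 1)"
proof -
  obtain v where v: "v \<in> V" "V = vec.span (insert v W)"
    using atoms_above_obtain_generator[OF V W] .
  have "vec.span (W \<union> \<Union>(insert V S)) = vec.span (insert v (W \<union> \<Union>S))" (is "?L = ?R")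
  proof
    have "V \<subseteq> ?R" unfolding v(2) by (intro vec.span_mono) auto
    moreover have "W \<union> \<Union>S \<subseteq> ?R" by (auto intro: vec.span_base)
    ultimately show "?L \<subseteq> ?R" by (intro vec.span_minimal) auto
    show "?R \<subseteq> ?L" using v(1) by (intro vec.span_mono) auto
  qed
  then have "vec.dim (join_above W (insert V S)) = vec.dim (insert v (W \<union> \<Union>S))"
    by (simp add: join_above_def)
  moreover have "v \<in> join_above W S \<longleftrightarrow> V \<subseteq> join_above W S"
  proof
    assume "v \<in> join_above W S"
    then show "V \<subseteq> join_above W S"
      unfolding v(2) using join_above_superset by (intro vec.span_minimal) auto
  qed (use v in auto)
  ultimately show ?thesis by (simp add: vec.dim_insert join_above_def)
qed

lemma dim_join_above_Un_le:
  assumes "finite R" "R \<subseteq> atoms_above W" and W: "vec.subspace W"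
  shows "vec.dim (join_above W (R \<union> S)) \<le> vec.dim (join_above W S) + card R"
  using assms(1,2)
proof (induction R)
  case (insert V R)
  then show ?case using dim_join_above_insert[OF _ W, of V "R \<union> S"] by auto
qed simp

lemma dim_join_above_le:
  assumes "finite S" "S \<subseteq> atoms_above W" and W: "vec.subspace W"
  shows "vec.dim (join_above W S) \<le> vec.dim W + card S"
  using dim_join_above_Un_le[OF assms, of "{}"] by (simp add: join_above_empty W)

text \<open>Adjoining \<open>T - S\<close> raises the dimension by at most
  \<open>card (T - S)\<close>, so a deficit of \<open>S\<close> would persist in
  \<open>T\<close>.\<close>

lemma independent_above_subset:
  fixes W :: "('a::{field,finite} ^ 'n) set"
  assumes "T \<subseteq> atoms_above W" "independent_above W T" "S \<subseteq> T" and W: "vec.subspace W"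
  shows "independent_above W S"
proof -
  have "vec.dim (join_above W ((T - S) \<union> S)) \<le> vec.dim (join_above W S) + card (T - S)"
    using assms by (intro dim_join_above_Un_le) auto
  moreover have "(T - S) \<union> S = T" using assms(3) by auto
  moreover have "card (T - S) = card T - card S" "card S \<le> card T"
    using assms(3) by (auto simp: card_Diff_subset card_mono)
  moreover have "vec.dim (join_above W S) \<le> vec.dim W + card S"
    using assms by (intro dim_join_above_le) auto
  ultimately show ?thesis using assms(2) by (simp add: independent_above_def)
qed

section \<open>Counting atoms and independent sets\<close>

text \<open>The sets \<open>V - W\<close>, for atoms \<open>V\<close> not below \<open>U\<close>,
  partition the complement of \<open>U\<close> into blocks of equal size.\<close>

lemma card_atoms_above_not_below:
  fixes W U :: "('a::{field,finite} ^ 'n) set"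
  assumes W: "vec.subspace W" and U: "vec.subspace U" "W \<subseteq> U"
  shows "(CARD('a) ^ Suc (vec.dim W) - CARD('a) ^ vec.dim W) * card {V \<in> atoms_above W. \<not> V \<subseteq> U}
    = CARD('a) ^ CARD('n) - CARD('a) ^ vec.dim U"
proof -
  let ?C = "(\<lambda>V. V - W) ` {V \<in> atoms_above W. \<not> V \<subseteq> U}"
  \<comment> \<open>A common vector outside \<open>W\<close> would generate \<open>V\<close> over
    \<open>W\<close> and so put \<open>V\<close> below \<open>U\<close>.\<close>
  have meet: "V \<inter> U = W" if V: "V \<in> atoms_above W" "\<not> V \<subseteq> U" for V
  proof -
    have "v \<in> W" if v: "v \<in> V" "v \<in> U" for v
    proof (rule ccontr)
      assume "v \<notin> W"
      then have "V = vec.span (insert v W)"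
        using atoms_above_eq_span_insert[OF V(1) v(1) _ W] by simp
      also have "\<dots> \<subseteq> U" using U v by (intro vec.span_minimal) auto
      finally show False using V by simp
    qed
    then show ?thesis using V U by (auto simp: subspaces_above_def)
  qed
  have union: "\<Union>?C = UNIV - U"
  proof
    show "\<Union>?C \<subseteq> UNIV - U" using meet by auto
    show "UNIV - U \<subseteq> \<Union>?C"
    proof
      fix v assume "v \<in> UNIV - U"
      then have v: "v \<notin> U" "v \<notin> W" using U by auto
      let ?V = "vec.span (insert v W)"
      have "v \<in> ?V" "W \<subseteq> ?V" by (auto intro: vec.span_base)
      moreover have "vec.dim ?V = Suc (vec.dim W)"
        using v W by (simp add: vec.dim_insert vec.span_eq_iff[THEN iffD2])
      ultimately show "v \<in> \<Union>?C"
        using v by (auto simp: subspaces_above_def intro!: bexI[of _ ?V])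
    qed
  qed
  have "inj_on (\<lambda>V. V - W) {V \<in> atoms_above W. \<not> V \<subseteq> U}"
    by (rule inj_onI) (auto simp: subspaces_above_def)
  then have cardC: "card ?C = card {V \<in> atoms_above W. \<not> V \<subseteq> U}" by (rule card_image)
  have "(CARD('a) ^ Suc (vec.dim W) - CARD('a) ^ vec.dim W) * card ?C = card (\<Union>?C)"
  proof (rule card_partition)
    fix c assume "c \<in> ?C"
    then obtain V where V: "c = V - W" "V \<in> atoms_above W" by auto
    then show "card c = CARD('a) ^ Suc (vec.dim W) - CARD('a) ^ vec.dim W"
      using card_subspace[of V] card_subspace[OF W]
      by (auto simp: subspaces_above_def card_Diff_subset)
  next
    fix c1 c2 assume c: "c1 \<in> ?C" "c2 \<in> ?C" "c1 \<noteq> c2"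
    then obtain V1 V2 where V: "c1 = V1 - W" "c2 = V2 - W" "V1 \<in> atoms_above W" "V2 \<in> atoms_above W"
      by auto
    \<comment> \<open>A vector common to both blocks generates either atom over
      \<open>W\<close>.\<close>
    have "V1 = V2" if "v \<in> c1" "v \<in> c2" for v
      using atoms_above_eq_span_insert[OF V(3) _ _ W, of v] atoms_above_eq_span_insert[OF V(4) _ _ W, of v]
        that V by simp
    then show "c1 \<inter> c2 = {}" using c V by auto
  qed auto
  also have "\<dots> = CARD('a) ^ CARD('n) - CARD('a) ^ vec.dim U"
    unfolding union using card_subspace[OF U(1)] by (simp add: card_Diff_subset)
  finally show ?thesis using cardC by simp
qed

lemma independent_above_insert:
  fixes W :: "('a::{field,finite} ^ 'n) set"
  assumes "V \<in> atoms_above W" "independent_above W S" "V \<notin> S" and W: "vec.subspace W"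
  shows "independent_above W (insert V S) \<longleftrightarrow> \<not> V \<subseteq> join_above W S"
  using assms dim_join_above_insert[OF assms(1) W, of S] by (simp add: independent_above_def)

text \<open>A Minkowski sum of subspaces is the span of their union. The index set is nonempty
  because the empty sum is \<open>{0}\<close>, whereas the empty join is the span of
  \<open>W\<close>.\<close>

lemma sum_eq_join_above:
  assumes "finite I" "I \<noteq> {}" "\<forall>i\<in>I. V i \<in> atoms_above W"
  shows "(\<Sum>i\<in>I. V i) = join_above W (V ` I)"
  using assms
proof (induction I rule: finite_ne_induct)
  case (singleton i)
  then have "W \<union> V i = V i" "vec.subspace (V i)" by (auto simp: subspaces_above_def)
  then show ?case by (simp add: join_above_def vec.span_eq_iff[THEN iffD2])
next
  case (insert i I)
  then have i: "W \<subseteq> V i" "vec.subspace (V i)" by (auto simp: subspaces_above_def)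
  have "(\<Sum>j\<in>insert i I. V j) = vec.span (V i) + vec.span (W \<union> \<Union>(V ` I))"
    using insert i by (simp add: join_above_def vec.span_eq_iff[THEN iffD2])
  also have "\<dots> = vec.span (V i \<union> (W \<union> \<Union>(V ` I)))"
    unfolding vec.span_Un by (auto simp: set_plus_def)
  also have "V i \<union> (W \<union> \<Union>(V ` I)) = W \<union> \<Union>(V ` insert i I)" by auto
  finally show ?case by (simp add: join_above_def)
qed

lemma one_less_card_field: "1 < CARD('a::{field,finite})"
proof -
  have "card {0, 1 :: 'a} \<le> CARD('a)" by (intro card_mono) auto
  then show ?thesis by simp
qed

text \<open>An independent set of size \<open>r\<close> extends by exactly the atoms not below its
  join; dividing the number of vectors outside the join by the block size gives \<open>q ^ r\<close>
  times a Gaussian coefficient. The extension count then applies.\<close>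

lemma card_independent_sets_above:
  fixes W :: "('a::{field,finite} ^ 'n) set"
  assumes W: "vec.subspace W" and B: "B \<subseteq> atoms_above W" "independent_above W B"
  shows "fact s * real (card {Y. Y \<subseteq> atoms_above W \<and> B \<inter> Y = {} \<and> card Y = s \<and> independent_above W (B \<union> Y)})
    = (\<Prod>i<s. real CARD('a) ^ (card B + i) *
         qbinomial CARD('a) (CARD('n) - vec.dim W - (card B + i)) 1)"
proof -
  let ?q = "CARD('a)" and ?n = "CARD('n) - vec.dim W"
  define a where "a r = ?q ^ r * (\<Sum>j<?n - r. ?q ^ j)" for r
  have q: "?q > 1" by (rule one_less_card_field)
  have dimW: "vec.dim S \<le> CARD('n)" for S :: "('a ^ 'n) set"
    using vec.dim_subset_UNIV[of S] by (simp add: vec.dimension_def card_cart_basis)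
  have ext: "card {V \<in> atoms_above W - S. independent_above W (insert V S)} = a (card S)"
    if S: "S \<subseteq> atoms_above W" "independent_above W S" for S
  proof -
    have dim: "vec.dim (join_above W S) = vec.dim W + card S"
      using S by (simp add: independent_above_def)
    have le: "vec.dim W + card S \<le> CARD('n)"
      using dimW[of "join_above W S"] dim by simp
    have below: "V \<subseteq> join_above W S" if "V \<in> S" for V
      using that vec.span_superset[of "W \<union> \<Union>S"] unfolding join_above_def by blast
    have "{V \<in> atoms_above W - S. independent_above W (insert V S)}
        = {V \<in> atoms_above W. \<not> V \<subseteq> join_above W S}"
      using independent_above_insert[OF _ S(2) _ W] below by auto
    then have eq: "(?q ^ Suc (vec.dim W) - ?q ^ vec.dim W) *
        card {V \<in> atoms_above W - S. independent_above W (insert V S)}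
        = ?q ^ CARD('n) - ?q ^ (vec.dim W + card S)"
      using card_atoms_above_not_below[OF W subspace_join_above join_above_superset] dim by simp
    \<comment> \<open>The identity is checked over the reals, where subtraction is not truncated,
      and then pulled back to \<open>nat\<close>.\<close>
    have "real ((?q ^ Suc (vec.dim W) - ?q ^ vec.dim W) * a (card S))
        = real ?q ^ (vec.dim W + card S) * ((real ?q - 1) * (\<Sum>j<?n - card S. real ?q ^ j))"
    proof -
      have "real (?q ^ Suc (vec.dim W) - ?q ^ vec.dim W) = real ?q ^ vec.dim W * (real ?q - 1)"
        using q by (simp add: of_nat_diff algebra_simps)
      then show ?thesis by (simp add: a_def power_add)
    qed
    also have "(real ?q - 1) * (\<Sum>j<?n - card S. real ?q ^ j) = real ?q ^ (?n - card S) - 1"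
      using q by (simp add: geometric_sum)
    also have "real ?q ^ (vec.dim W + card S) * (real ?q ^ (?n - card S) - 1)
        = real ?q ^ CARD('n) - real ?q ^ (vec.dim W + card S)"
    proof -
      have "vec.dim W + card S + (?n - card S) = CARD('n)" using le by simp
      then have "real ?q ^ (vec.dim W + card S) * real ?q ^ (?n - card S) = real ?q ^ CARD('n)"
        by (metis power_add)
      then show ?thesis by (simp only: right_diff_distrib mult_1_right)
    qed
    also have "\<dots> = real (?q ^ CARD('n) - ?q ^ (vec.dim W + card S))"
    proof -
      have "?q ^ (vec.dim W + card S) \<le> ?q ^ CARD('n)"
        using q le by (intro power_increasing) auto
      then show ?thesis by (simp only: of_nat_diff of_nat_power)
    qed
    finally have "(?q ^ Suc (vec.dim W) - ?q ^ vec.dim W) * a (card S)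
        = ?q ^ CARD('n) - ?q ^ (vec.dim W + card S)"
      by (simp only: of_nat_eq_iff)
    then have "(?q ^ Suc (vec.dim W) - ?q ^ vec.dim W) *
        card {V \<in> atoms_above W - S. independent_above W (insert V S)}
        = (?q ^ Suc (vec.dim W) - ?q ^ vec.dim W) * a (card S)"
      using eq by (simp only:)
    moreover have "?q ^ Suc (vec.dim W) - ?q ^ vec.dim W > 0" using q by simp
    ultimately show ?thesis by (rule nat_mult_eq_cancel1[THEN iffD1, rotated])
  qed
  have "fact s * card {Y. Y \<subseteq> atoms_above W \<and> B \<inter> Y = {} \<and> card Y = s \<and> independent_above W (B \<union> Y)}
    = (\<Prod>i<s. a (card B + i))"
    by (rule card_independent_extensions[OF _ independent_above_subset[OF _ _ _ W] ext B]) simp_all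
  then have "real (fact s * card {Y. Y \<subseteq> atoms_above W \<and> B \<inter> Y = {} \<and> card Y = s \<and> independent_above W (B \<union> Y)})
    = (\<Prod>i<s. real (a (card B + i)))"
    by simp
  then show ?thesis unfolding qbinomial_one_eq_sum[OF q] a_def by simp
qed

section \<open>Dimension conditions as independence\<close>

text \<open>The dimension \<open>r\<close> is the largest that \<open>card I\<close> atoms can
  reach. Attaining it forces equality in two bounds: no atom is repeated, and the atoms are
  independent.\<close>

lemma sum_atoms_above_iff:
  fixes W :: "('a::{field,finite} ^ 'n) set"
  assumes I: "finite I" "I \<noteq> {}" and V: "\<forall>i\<in>I. V i \<in> atoms_above W" and W: "vec.subspace W"
    and r: "r = vec.dim W + card I"
  shows "(\<Sum>i\<in>I. V i) \<in> subspaces_above W r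
    \<longleftrightarrow> inj_on V I \<and> independent_above W (V ` I)"
proof -
  have "vec.dim (join_above W (V ` I)) \<le> vec.dim W + card (V ` I)"
    using I V W by (intro dim_join_above_le) auto
  moreover have "card (V ` I) \<le> card I" using I by (intro card_image_le)
  moreover have "inj_on V I \<longleftrightarrow> card (V ` I) = card I"
    using I by (auto simp: card_image intro: eq_card_imp_inj_on)
  ultimately show ?thesis
    unfolding sum_eq_join_above[OF I V] r
    by (auto simp: subspaces_above_def independent_above_def join_above_superset[THEN subsetD])
qed

lemma XX_eq_independent_above:
  fixes W :: "('a::{field,finite} ^ 'n) set"
  assumes W: "vec.subspace W" and t: "t = Suc (vec.dim W)"
  shows "XX t W = {X. X \<subseteq> atoms_above W \<and> card X = 2 \<and> independent_above W X}"
proof -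
  \<comment> \<open>Indexing the pair by \<open>bool\<close> turns \<open>V1 \<noteq> V2\<close>
    into injectivity of the family.\<close>
  have pair: "V1 + V2 \<in> subspaces_above W (t + 1) \<longleftrightarrow> V1 \<noteq> V2 \<and> independent_above W {V1, V2}"
    if "V1 \<in> atoms_above W" "V2 \<in> atoms_above W" for V1 V2
    using sum_atoms_above_iff[of "UNIV :: bool set" "\<lambda>b. if b then V1 else V2" W "t + 1"] that W t
    by (auto simp: UNIV_bool inj_on_def ex_bool_eq add.commute insert_commute)
  show ?thesis
  proof (intro equalityI subsetI)
    fix X assume "X \<in> XX t W"
    then obtain V1 V2 where "X = {V1, V2}" "V1 \<in> atoms_above W" "V2 \<in> atoms_above W"
      "V1 + V2 \<in> subspaces_above W (t + 1)"
      unfolding XX_def t by blast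
    then show "X \<in> {X. X \<subseteq> atoms_above W \<and> card X = 2 \<and> independent_above W X}"
      using pair[of V1 V2] by simp
  next
    fix X assume X: "X \<in> {X. X \<subseteq> atoms_above W \<and> card X = 2 \<and> independent_above W X}"
    then obtain V1 V2 where V: "X = {V1, V2}" "V1 \<noteq> V2" by (auto simp: card_2_iff)
    then show "X \<in> XX t W"
      unfolding XX_def using X pair[of V1 V2] t by blast
  qed
qed

lemma YY_eq_independent_above:
  fixes W :: "('a::{field,finite} ^ 'n) set"
  assumes W: "vec.subspace W" and t: "t = Suc (vec.dim W)"
  shows "YY m t W = {Y. Y \<subseteq> atoms_above W \<and> card Y = m + 1 \<and> independent_above W Y}"
proof -
  have fam: "(\<Sum>i = 1..m + 1. V i) \<in> subspaces_above W (m + t)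
      \<longleftrightarrow> inj_on V {1..m + 1} \<and> independent_above W (V ` {1..m + 1})"
    if "\<forall>i\<in>{1..m + 1}. V i \<in> atoms_above W" for V
    by (rule sum_atoms_above_iff[OF _ _ _ W]) (use that t in simp_all)
  show ?thesis
  proof (intro equalityI subsetI)
    fix Y assume "Y \<in> YY m t W"
    then obtain V where V: "Y = V ` {1..m + 1}" "\<forall>i\<in>{1..m + 1}. V i \<in> atoms_above W"
      "(\<Sum>i = 1..m + 1. V i) \<in> subspaces_above W (m + t)"
      unfolding YY_def t by blast
    then show "Y \<in> {Y. Y \<subseteq> atoms_above W \<and> card Y = m + 1 \<and> independent_above W Y}"
      using fam[OF V(2)] by (auto simp: card_image)
  next
    fix Y assume Y: "Y \<in> {Y. Y \<subseteq> atoms_above W \<and> card Y = m + 1 \<and> independent_above W Y}"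
    then obtain V where V: "bij_betw V {1..m + 1} Y"
      using ex_bij_betw_nat_finite_1[of Y] by auto
    then have "Y = V ` {1..m + 1}" "inj_on V {1..m + 1}" by (auto simp: bij_betw_def)
    moreover from this have "\<forall>i\<in>{1..m + 1}. V i \<in> atoms_above W" using Y by blast
    ultimately show "Y \<in> YY m t W"
      unfolding YY_def using Y fam[of V] t by (intro CollectI exI[of _ V]) simp
  qed
qed

text \<open>The two sums merge into one over the disjoint sum \<open>X <+> Y\<close>, on which the
  forgetful map is injective iff \<open>X\<close> and \<open>Y\<close> are disjoint. The required
  dimension is maximal for these \<open>m + 3\<close> atoms.\<close>

lemma subspace_vertices_eq_independent_above:
  fixes W :: "('a::{field,finite} ^ 'n) set"
  assumes W: "vec.subspace W" and t: "t = Suc (vec.dim W)"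
  shows "subspace_vertices m t W
    = {(X, Y) \<in> XX t W \<times> YY m t W. X \<inter> Y = {} \<and> independent_above W (X \<union> Y)}"
proof -
  have "(\<Sum>V\<in>X. V) + (\<Sum>V\<in>Y. V) \<in> subspaces_above W (m + t + 2)
      \<longleftrightarrow> X \<inter> Y = {} \<and> independent_above W (X \<union> Y)" if "X \<in> XX t W" "Y \<in> YY m t W" for X Y
  proof -
    let ?V = "case_sum id id :: _ \<Rightarrow> ('a ^ 'n) set"
    have X: "X \<subseteq> atoms_above W" "card X = 2" and Y: "Y \<subseteq> atoms_above W" "card Y = m + 1"
      using that W t by (auto simp: XX_eq_independent_above YY_eq_independent_above)
    have sum: "(\<Sum>V\<in>X. V) + (\<Sum>V\<in>Y. V) = (\<Sum>i\<in>X <+> Y. ?V i)"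
      by (simp add: sum.Plus)
    have image: "?V ` (X <+> Y) = X \<union> Y" by (auto simp: Plus_def image_Un image_image)
    have inj: "inj_on ?V (X <+> Y) \<longleftrightarrow> X \<inter> Y = {}"
      by (auto simp: inj_on_def Plus_def ball_Un)
    show ?thesis
      unfolding sum image[symmetric] inj[symmetric]
    proof (rule sum_atoms_above_iff[OF _ _ _ W])
      show "\<forall>i\<in>X <+> Y. ?V i \<in> atoms_above W" using X Y by (auto simp: Plus_def)
      show "m + t + 2 = vec.dim W + card (X <+> Y)" using X Y t by (simp add: card_Plus)
    qed (use X in auto)
  qed
  then show ?thesis unfolding subspace_vertices_def by blast
qed

subsection \<open>The subspace graph\<close>

theorem theorem1:
  fixes W :: "('a::{field,finite} ^ 'n) set" and q k m t :: nat
  assumes q: "q = CARD('a)" and k: "k = CARD('n)"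
    and pos: "k > 0" "m > 0" "t > 0" and le: "m + t + 2 \<le> k"
    and W: "vec.subspace W" "vec.dim W = t - 1"
  shows "\<exists>c d :: nat.
     real c = real q ^ (2 * m + 3) / 2
       * qbinomial q (k - m - t) 1 * qbinomial q (k - m - t - 1) 1 \<and>
     d = (m + 3) choose 2 \<and>
     cd_caching_line_graph (XX t W) (YY m t W) c d (subspace_graph m t W) \<and>
     real (card (XX t W)) = real q / 2 * qbinomial q (k - t + 1) 1 * qbinomial q (k - t) 1 \<and>
     real (card (YY m t W)) = qbinomial q (k - t + 1) (m + 1)
       * ((\<Prod>i=0..m. real q ^ (m + 1) - real q ^ i) / (fact (m + 1) * (real q - 1) ^ (m + 1))) \<and>
     (\<forall>N P. N > 0 \<and> delivery_cover (subspace_graph m t W) d P \<longrightarrow>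
        coded_caching_scheme TYPE('g::ab_group_add) (XX t W) (YY m t W) N
          (subspace_graph m t W) P \<and>
        (\<exists>M. has_cache_size (XX t W) (YY m t W) N (subspace_graph m t W) M \<and>
           M / real N = 1 - real q ^ (2 * (m + 1))
             * ((qbinomial q (k - m - t) 1 * qbinomial q (k - m - t - 1) 1)
                / (qbinomial q (k - t + 1) 1 * qbinomial q (k - t) 1))) \<and>
        rate (YY m t W) P = real q ^ (2 * m + 3) / (real (m + 2) * real (m + 3))
          * qbinomial q (k - m - t) 1 * qbinomial q (k - m - t - 1) 1)"
proof -
  let ?K = "XX t W" and ?F = "YY m t W" and ?G = "subspace_graph m t W"
    and ?V = "subspace_vertices m t W" and ?at = "atoms_above W"
  let ?A = "qbinomial q (k - m - t) 1" and ?B = "qbinomial q (k - m - t - 1) 1"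
    and ?A' = "qbinomial q (k - t + 1) 1" and ?B' = "qbinomial q (k - t) 1"
  \<comment> \<open>The number of points outside a flat of rank \<open>r\<close>;
    \<open>k - t + 1\<close> is the dimension of the quotient by \<open>W\<close>.\<close>
  define g where "g r = real q ^ r * qbinomial q (k - t + 1 - r) 1" for r
  define d where "d = (m + 3) choose 2"
  define ext where "ext B s = {Y. Y \<subseteq> ?at \<and> B \<inter> Y = {} \<and> card Y = s \<and> independent_above W (B \<union> Y)}"
    for B s
  have q1: "q > 1" unfolding q by (rule one_less_card_field)
  have t: "t = Suc (vec.dim W)" using W pos by simp
  have n: "k - vec.dim W = k - t + 1" using W le pos by simp
  note XX = XX_eq_independent_above[OF W(1) t] and YY = YY_eq_independent_above[OF W(1) t, of m]
    and VV = subspace_vertices_eq_independent_above[OF W(1) t, of m]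
  have count: "fact s * real (card (ext B s)) = (\<Prod>i<s. g (card B + i))"
    if "B \<subseteq> ?at" "independent_above W B" for B s
    using card_independent_sets_above[OF W(1) that, of s]
    by (simp add: ext_def g_def n flip: q k)
  have gpos: "g r > 0" if "r \<le> m + 2" for r
    unfolding g_def using q1 that le by (intro mult_pos_pos qbinomial_one_pos) auto
  have indep_empty: "independent_above W {}"
    by (simp add: independent_above_def join_above_empty[OF W(1)])
  have XX_ext: "?K = ext {} 2" and YY_ext: "?F = ext {} (m + 1)"
    by (auto simp: XX YY ext_def)
  \<comment> \<open>Membership in \<open>XX\<close> or \<open>YY\<close> requires each part to be
    independent by itself; this follows from independence of the union.\<close>
  have sub_indep: "independent_above W S" if "independent_above W (S \<union> T)" "S \<subseteq> ?at" "T \<subseteq> ?at" for S T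
    by (rule independent_above_subset[OF _ that(1) _ W(1)]) (use that in auto)
  have row_eq: "{Y \<in> ?F. (X, Y) \<in> ?V} = ext X (m + 1)" if X: "X \<in> ?K" for X
  proof -
    have "independent_above W Y" if "independent_above W (X \<union> Y)" "Y \<subseteq> ?at" for Y
      using sub_indep[of Y X] that X by (simp add: XX Un_commute)
    then show ?thesis using X by (auto simp: VV ext_def XX YY)
  qed
  have col_eq: "{X \<in> ?K. (X, Y) \<in> ?V} = ext Y 2" if Y: "Y \<in> ?F" for Y
  proof -
    have "independent_above W X" if "independent_above W (Y \<union> X)" "X \<subseteq> ?at" for X
      using sub_indep[of X Y] that Y by (simp add: YY Un_commute)
    then show ?thesis using Y by (auto simp: VV ext_def XX YY Un_commute Int_commute)
  qed
  \<comment> \<open>The constants are read off at an arbitrary subfile and user;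
    \<open>count\<close> shows that the choice does not matter, and \<open>K\<close> and
    \<open>F\<close> that one exists.\<close>
  define c where "c = card (ext (SOME Y. Y \<in> ?F) 2)"
  define D where "D = card (ext (SOME X. X \<in> ?K) (m + 1))"
  have countK: "2 * real (card ?K) = g 0 * g 1"
    using count[of "{}" 2] indep_empty by (simp add: XX_ext numeral_2_eq_2)
  have countF: "fact (m + 1) * real (card ?F) = (\<Prod>i<m + 1. g i)"
    using count[of "{}" "m + 1"] indep_empty unfolding YY_ext by simp
  have K: "card ?K > 0" and F: "card ?F > 0"
  proof -
    have "2 * real (card ?K) > 0" unfolding countK using gpos by simp
    then show "card ?K > 0" by simp
    have "fact (m + 1) * real (card ?F) > 0" unfolding countF using gpos by (intro prod_pos) auto
    then show "card ?F > 0" by (simp add: zero_less_mult_iff)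
  qed
  have countC: "2 * real (card (ext Y 2)) = g (m + 1) * g (m + 2)" if "Y \<in> ?F" for Y
    using count[of Y 2] that by (simp add: YY numeral_2_eq_2)
  have countD: "fact (m + 1) * real (card (ext X (m + 1))) = (\<Prod>i<m + 1. g (2 + i))" if "X \<in> ?K" for X
    using count[of X "m + 1"] that by (simp add: XX)
  have someF: "(SOME Y. Y \<in> ?F) \<in> ?F" and someK: "(SOME X. X \<in> ?K) \<in> ?K"
    using K F by (auto simp: some_in_eq)
  have c: "card (ext Y 2) = c" if "Y \<in> ?F" for Y
    using countC[OF that] countC[OF someF] by (simp add: c_def)
  have D: "card (ext X (m + 1)) = D" if "X \<in> ?K" for X
    using countD[OF that] countD[OF someK] unfolding D_def
    by (metis fact_nonzero mult_cancel_left of_nat_eq_iff)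
  have c2: "2 * real c = g (m + 1) * g (m + 2)"
    using countC[OF someF] by (simp add: c_def)
  have "2 * real c > 0" unfolding c2 using gpos by simp
  then have cpos: "c > 0" by simp
  have "fact (m + 1) * real D = (\<Prod>i<m + 1. g (2 + i))"
    using countD[OF someK] by (simp only: D_def)
  also have "\<dots> > 0" using gpos by (intro prod_pos) auto
  finally have "fact (m + 1) * real D > 0" .
  then have Dpos: "D > 0" by (simp add: zero_less_mult_iff)

  have VKF: "?V \<subseteq> ?K \<times> ?F" by (auto simp: VV)
  have row: "card {Y \<in> ?F. (X, Y) \<in> ?V} = D" if "X \<in> ?K" for X
    using row_eq[OF that] D[OF that] by simp
  have col: "card {X \<in> ?K. (X, Y) \<in> ?V} = c" if "Y \<in> ?F" for Y
    using col_eq[OF that] c[OF that] by simp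
  note G = caching_line_graph_product[OF _ _ VKF row Dpos col cpos, folded subspace_graph_def]
  have clg: "caching_line_graph ?K ?F c ?G"
    and uc: "\<And>X. X \<in> ?K \<Longrightarrow> card (user_clique ?G ?F X) = D"
    and cardV: "card ?V = card ?K * D"
    using G by auto
  have vG: "vertices ?G = ?V" by (simp add: subspace_graph_def)
  have "delivery_cover ?G d
      ((\<lambda>Z. {(X, Y) \<in> vertices ?G. X \<union> Y = Z}) ` (\<lambda>(X, Y). X \<union> Y) ` vertices ?G)"
    unfolding d_def
  proof (rule delivery_cover_unions)
    show "simple_graph ?G" by (auto simp: simple_graph_def subspace_graph_def)
    fix X Y X' assume v: "(X, Y) \<in> vertices ?G"
    then have XY: "X \<subseteq> ?at" "card X = 2" "Y \<subseteq> ?at" "card Y = m + 1" "X \<inter> Y = {}"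
        "independent_above W (X \<union> Y)"
      unfolding vG VV XX YY by auto
    then show "X \<inter> Y = {}" "card X = 2" by auto
    show XY_card: "finite (X \<union> Y) \<and> card (X \<union> Y) = m + 3"
      using XY by (simp add: card_Un_disjoint)
    assume X': "X' \<subseteq> X \<union> Y" "card X' = 2"
    then have "card ((X \<union> Y) - X') = m + 1" using XY_card by (simp add: card_Diff_subset)
    moreover have "X' \<union> ((X \<union> Y) - X') = X \<union> Y" using X' by auto
    moreover have "independent_above W X'" "independent_above W ((X \<union> Y) - X')"
      using independent_above_subset[OF _ XY(6) _ W(1)] XY X' by auto
    ultimately show "(X', (X \<union> Y) - X') \<in> vertices ?G"
      unfolding vG VV XX YY using XY X' by auto
  qed (auto simp: subspace_graph_def)
  then have cd: "cd_caching_line_graph ?K ?F c d ?G"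
    using clg by (auto simp: cd_caching_line_graph_def)

  \<comment> \<open>Ranks \<open>m + 1\<close> and \<open>m + 2\<close> arise when two points are
    added to some \<open>Y\<close>, ranks \<open>0\<close> and \<open>1\<close> when a pair is built
    from nothing.\<close>
  have g_top: "g (m + 1) = real q ^ (m + 1) * ?A" "g (m + 2) = real q ^ (m + 2) * ?B"
    and g_bot: "g 0 = ?A'" "g 1 = real q * ?B'"
    using le pos by (simp_all add: g_def add.commute)
  have c_eq: "real c = real q ^ (2 * m + 3) / 2 * ?A * ?B"
  proof -
    have "2 * real c = real q ^ ((m + 1) + (m + 2)) * ?A * ?B"
      unfolding c2 g_top power_add by simp
    also have "(m + 1) + (m + 2) = 2 * m + 3" by simp
    finally show ?thesis by simp
  qed
  have K_eq: "real (card ?K) = real q / 2 * ?A' * ?B'"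
    using countK unfolding g_bot by (simp add: mult_ac)
  have F_eq: "real (card ?F) = qbinomial q (k - t + 1) (m + 1)
      * ((\<Prod>i=0..m. real q ^ (m + 1) - real q ^ i) / (fact (m + 1) * (real q - 1) ^ (m + 1)))"
  proof -
    have "{0..m} = {..<m + 1}" by auto
    then have "fact (m + 1) * real (card ?F) = qbinomial q (k - t + 1) (m + 1)
      * ((\<Prod>i=0..m. real q ^ (m + 1) - real q ^ i) / (real q - 1) ^ (m + 1))"
      unfolding countF g_def using qbinomial_mult_prod_diff[OF q1, of "k - t + 1" "m + 1"] by simp
    moreover have "y = u * (v / (x * w))" if "x * y = u * (v / w)" "x \<noteq> 0" for x y u v w :: real
    proof -
      have "y = (x * y) / x" using that(2) by simp
      also have "\<dots> = u * (v / (x * w))" unfolding that(1) by (simp add: mult.commute)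
      finally show ?thesis .
    qed
    ultimately show ?thesis using fact_nonzero by blast
  qed
  have "2 * d = (m + 2) * (m + 3)"
    using two_mult_choose_two[of "m + 3"] by (simp add: d_def mult.commute)
  then have d2: "2 * real d = real (m + 2) * real (m + 3)"
    by (metis of_nat_mult of_nat_numeral)
  have dpos: "d > 0"
    by (simp add: d_def zero_less_binomial_iff)
  \<comment> \<open>Replacing \<open>D / F\<close> by \<open>c / K\<close> avoids cancelling the
    long products for \<open>D\<close> and \<open>F\<close>.\<close>
  have "D * card ?K = c * card ?F"
    using card_eq_sum_subfile_cliques[OF clg] cardV vG by (simp add: mult.commute)
  then have "real D * real (card ?K) = real c * real (card ?F)"
    by (metis of_nat_mult)
  then have "real D / real (card ?F) = real c / real (card ?K)"
    using K F by (subst frac_eq_eq) auto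
  also have "\<dots> = real q ^ (2 * (m + 1)) * ((?A * ?B) / (?A' * ?B'))"
  proof -
    have "real q ^ (2 * m + 3) = real q ^ (2 * (m + 1)) * real q"
    proof -
      have "2 * m + 3 = Suc (2 * (m + 1))" by simp
      then show ?thesis by (simp only: power_Suc2)
    qed
    moreover have "?A' > 0" "?B' > 0" using q1 le by (simp_all add: qbinomial_one_pos del: One_nat_def)
    moreover have "(p * r / 2 * x * y) / (r / 2 * x' * y') = p * ((x * y) / (x' * y'))"
      if "r > 0" "x' > 0" "y' > 0" for p r x y x' y' :: real
      using that by (simp add: field_simps)
    ultimately show ?thesis unfolding c_eq K_eq using q1 by simp
  qed
  finally have cache: "real D / real (card ?F) = real q ^ (2 * (m + 1)) * ((?A * ?B) / (?A' * ?B'))" .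
  have FF: "?F \<noteq> {}" using F by auto
  have "coded_caching_scheme TYPE('g::ab_group_add) ?K ?F N ?G P \<and>
      (\<exists>M. has_cache_size ?K ?F N ?G M \<and>
         M / real N = 1 - real q ^ (2 * (m + 1)) * ((?A * ?B) / (?A' * ?B'))) \<and>
      rate ?F P = real q ^ (2 * m + 3) / (real (m + 2) * real (m + 3)) * ?A * ?B"
    if N: "N > 0" and P: "delivery_cover ?G d P" for N P
  proof (intro conjI exI)
    show "coded_caching_scheme TYPE('g) ?K ?F N ?G P"
      by (rule coded_caching_scheme_delivery_cover[OF clg P])
    show "has_cache_size ?K ?F N ?G (real N * (1 - real D / real (card ?F)))"
      by (rule has_cache_size_user_clique[OF clg uc FF N])
    show "real N * (1 - real D / real (card ?F)) / real N
        = 1 - real q ^ (2 * (m + 1)) * ((?A * ?B) / (?A' * ?B'))"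
      unfolding cache using N by simp
    \<comment> \<open>Doubling clears the halves in \<open>c\<close> and in the binomial coefficient
      \<open>d\<close>.\<close>
    have "rate ?F P = (2 * real c) / (2 * real d)"
      using rate_delivery_cover[OF clg P FF dpos] by simp
    also have "\<dots> = real q ^ (2 * m + 3) / (real (m + 2) * real (m + 3)) * ?A * ?B"
      unfolding d2 c_eq by simp
    finally show "rate ?F P = \<dots>" .
  qed
  then show ?thesis using c_eq d_def cd K_eq F_eq by blast
qed

end
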